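(* Let $U\subset\mathbb{R}^2$ be an open connected set, let $f=(f_1,f_2):U\to\mathbb{R}^2$ be a $C^2$ map such that $\det Df(z)\neq 0$ for every $z\in U$, and let $z_0\in U$ be such that $f(z_0)=(0,0)$. Let $H_f=\frac{f_1^2+f_2^2}{2}:U\to\mathbb{R}$ and let $\nabla H_f^{\perp}=(-(H_f)_y,(H_f)_x)$ be the associated Hamiltonian vector field on $U$ (for which $z_0$ is a center). Then the center $z_0$ of $\nabla H_f^{\perp}$ is global if and only if both of the following hold: (i) $f$ is injective, and (ii) $f(U)=\mathbb{R}^2$ or $f(U)$ is an open disc centered at $(0,0)$.
   Context: Let $\mathcal{X}$ be a $C^1$ vector field on an open connected set $U\subset\mathbb{R}^2$. An isolated singular point (zero) $z_0$ of $\mathcal{X}$ is a center if there is a neighborhood $V\subset U$ of $z_0$ such that every orbit of $\mathcal{X}$ in $V\setminus\{z_0\}$ is periodic (non-constant). The period annulus $\mathcal{P}_{z_0}$ of a center $z_0$ is the maximal open connected set $W\subset U$ containing $z_0$ such that $W\setminus\{z_0\}$ is filled with (i.e. is a union of) periodic orbits of $\mathcal{X}$. The center $z_0$ is global if $\mathcal{P}_{z_0}=U$. *)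

theory Defs
  imports "HOL-Analysis.Analysis"
begin

section \<open>Maps of class \<open>C\<^sup>k\<close> on an open set\<close>

text \<open>Iterated directional derivatives of order below \<open>k\<close> are differentiable on \<open>U\<close>, those of
  order \<open>k\<close> are continuous on \<open>U\<close>. On a finite-dimensional domain and an open set \<open>U\<close> this is
  the usual \<open>C\<^sup>k\<close>; only the values of \<open>f\<close> on \<open>U\<close> matter.\<close>

primrec Ck_on :: "nat \<Rightarrow> ('a::euclidean_space \<Rightarrow> 'b::real_normed_vector) \<Rightarrow> 'a set \<Rightarrow> bool" where
  "Ck_on 0 f U \<longleftrightarrow> continuous_on U f"
| "Ck_on (Suc k) f U \<longleftrightarrow>
     (\<forall>z\<in>U. f differentiable at z) \<and> (\<forall>v. Ck_on k (\<lambda>z. frechet_derivative f (at z) v) U)"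

section \<open>Orbits of planar vector fields\<close>

text \<open>A vector field is a total function of which only the values on a domain \<open>D\<close>
  are used. The notions below are meant for \<open>D\<close> open and \<open>X\<close> of class \<open>C\<^sup>1\<close> on \<open>D\<close>, so that
  every point of \<open>D\<close> lies on exactly one orbit in \<open>D\<close>.\<close>

definition solution_on ::
    "(real^2 \<Rightarrow> real^2) \<Rightarrow> (real^2) set \<Rightarrow> real set \<Rightarrow> (real \<Rightarrow> real^2) \<Rightarrow> bool" where
  "solution_on X D I \<gamma> \<longleftrightarrow>
     open I \<and> is_interval I \<and> I \<noteq> {} \<and>
     (\<forall>t\<in>I. \<gamma> t \<in> D \<and> (\<gamma> has_vector_derivative X (\<gamma> t)) (at t))"

definition is_orbit :: "(real^2 \<Rightarrow> real^2) \<Rightarrow> (real^2) set \<Rightarrow> (real^2) set \<Rightarrow> bool" where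
  "is_orbit X D \<Gamma> \<longleftrightarrow>
     (\<exists>I \<gamma>. solution_on X D I \<gamma> \<and>
            (\<forall>J \<delta>. solution_on X D J \<delta> \<and> I \<subseteq> J \<and> (\<forall>t\<in>I. \<delta> t = \<gamma> t) \<longrightarrow> J = I) \<and>
            \<Gamma> = \<gamma> ` I)"

definition is_periodic_orbit :: "(real^2 \<Rightarrow> real^2) \<Rightarrow> (real^2) set \<Rightarrow> (real^2) set \<Rightarrow> bool" where
  "is_periodic_orbit X D \<Gamma> \<longleftrightarrow>
     (\<exists>\<gamma> T. solution_on X D UNIV \<gamma> \<and> 0 < T \<and> (\<forall>t. \<gamma> (t + T) = \<gamma> t) \<and>
            \<not> \<gamma> constant_on UNIV \<and> \<Gamma> = range \<gamma>)"

lemma is_orbit_if_is_periodic_orbit: "is_periodic_orbit X D \<Gamma> \<Longrightarrow> is_orbit X D \<Gamma>"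
proof -
  assume "is_periodic_orbit X D \<Gamma>"
  then obtain \<gamma> where "solution_on X D UNIV \<gamma>" "\<Gamma> = range \<gamma>"
    unfolding is_periodic_orbit_def by (elim exE conjE)
  then show ?thesis
    unfolding is_orbit_def by (intro exI[of _ UNIV] exI[of _ \<gamma>]) (simp add: top.extremum_unique)
qed

section \<open>Centers and period annuli\<close>

text \<open>The orbits of \<open>X\<close> in \<open>V - {z\<^sub>0}\<close> are those of the restricted field, i.e. maximality of the
  solution is understood inside \<open>V - {z\<^sub>0}\<close>. So an orbit that leaves \<open>V\<close>, or tends to \<open>z\<^sub>0\<close>,
  is not exempted: its pieces in \<open>V - {z\<^sub>0}\<close> are non-periodic orbits.\<close>

definition is_center :: "(real^2 \<Rightarrow> real^2) \<Rightarrow> (real^2) set \<Rightarrow> real^2 \<Rightarrow> bool" where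
  "is_center X U z\<^sub>0 \<longleftrightarrow>
     z\<^sub>0 isolated_in {z \<in> U. X z = 0} \<and>
     (\<exists>V. open V \<and> z\<^sub>0 \<in> V \<and> V \<subseteq> U \<and>
          (\<forall>\<Gamma>. is_orbit X (V - {z\<^sub>0}) \<Gamma> \<longrightarrow> is_periodic_orbit X (V - {z\<^sub>0}) \<Gamma>))"

definition punctured_filled :: "(real^2 \<Rightarrow> real^2) \<Rightarrow> (real^2) set \<Rightarrow> real^2 \<Rightarrow> (real^2) set \<Rightarrow> bool" where
  "punctured_filled X U z\<^sub>0 W \<longleftrightarrow>
     open W \<and> connected W \<and> z\<^sub>0 \<in> W \<and> W \<subseteq> U \<and>
     (\<exists>\<O>. (\<forall>\<Gamma>\<in>\<O>. is_periodic_orbit X U \<Gamma>) \<and> W - {z\<^sub>0} = \<Union>\<O>)"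

text \<open>The maximal \<open>W\<close> is the union of all of them, which is again of this kind.\<close>

definition period_annulus :: "(real^2 \<Rightarrow> real^2) \<Rightarrow> (real^2) set \<Rightarrow> real^2 \<Rightarrow> (real^2) set" where
  "period_annulus X U z\<^sub>0 = \<Union>{W. punctured_filled X U z\<^sub>0 W}"

lemma punctured_filled_subset_period_annulus:
  "punctured_filled X U z\<^sub>0 W \<Longrightarrow> W \<subseteq> period_annulus X U z\<^sub>0"
  unfolding period_annulus_def by blast

lemma punctured_filled_period_annulus:
  assumes "punctured_filled X U z\<^sub>0 W"
  shows "punctured_filled X U z\<^sub>0 (period_annulus X U z\<^sub>0)"
proof -
  let ?\<W> = "{W. punctured_filled X U z\<^sub>0 W}"
  let ?\<O> = "{\<Gamma>. is_periodic_orbit X U \<Gamma> \<and> \<Gamma> \<subseteq> \<Union>?\<W> - {z\<^sub>0}}"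
  have "open (\<Union>?\<W>)"
    by (intro open_Union) (auto simp: punctured_filled_def)
  moreover have "connected (\<Union>?\<W>)"
    by (rule connected_Union) (auto simp: punctured_filled_def)
  moreover have "\<exists>\<O>. (\<forall>\<Gamma>\<in>\<O>. is_periodic_orbit X U \<Gamma>) \<and> \<Union>?\<W> - {z\<^sub>0} = \<Union>\<O>"
  proof (intro exI[of _ ?\<O>] conjI)
    show "\<forall>\<Gamma>\<in>?\<O>. is_periodic_orbit X U \<Gamma>" by simp
    show "\<Union>?\<W> - {z\<^sub>0} = \<Union>?\<O>"
    proof (intro equalityI subsetI)
      fix p assume "p \<in> \<Union>?\<W> - {z\<^sub>0}"
      then obtain W' where W': "punctured_filled X U z\<^sub>0 W'" "p \<in> W' - {z\<^sub>0}" by blast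
      then obtain \<O> where \<O>: "\<forall>\<Gamma>\<in>\<O>. is_periodic_orbit X U \<Gamma>" "W' - {z\<^sub>0} = \<Union>\<O>"
        unfolding punctured_filled_def by blast
      then obtain \<Gamma> where "\<Gamma> \<in> \<O>" "p \<in> \<Gamma>" using W'(2) by blast
      moreover from this have "\<Gamma> \<subseteq> \<Union>?\<W> - {z\<^sub>0}" using \<O>(2) W'(1) by blast
      ultimately show "p \<in> \<Union>?\<O>" using \<O>(1) by blast
    qed blast
  qed
  moreover have "z\<^sub>0 \<in> \<Union>?\<W>" "\<Union>?\<W> \<subseteq> U"
    using assms by (auto simp: punctured_filled_def)
  ultimately show ?thesis
    unfolding period_annulus_def punctured_filled_def[of X U z\<^sub>0 "\<Union>?\<W>"] by (intro conjI)
qed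

definition is_global_center :: "(real^2 \<Rightarrow> real^2) \<Rightarrow> (real^2) set \<Rightarrow> real^2 \<Rightarrow> bool" where
  "is_global_center X U z\<^sub>0 \<longleftrightarrow> is_center X U z\<^sub>0 \<and> period_annulus X U z\<^sub>0 = U"

section \<open>The Hamiltonian vector field of a planar map\<close>

definition partial :: "2 \<Rightarrow> (real^2 \<Rightarrow> real) \<Rightarrow> real^2 \<Rightarrow> real" where
  "partial i h z = frechet_derivative h (at z) (axis i 1)"

definition perp_gradient :: "(real^2 \<Rightarrow> real) \<Rightarrow> real^2 \<Rightarrow> real^2" where
  "perp_gradient h z = vector [- partial 2 h z, partial 1 h z]"

definition hamiltonian :: "(real^2 \<Rightarrow> real^2) \<Rightarrow> real^2 \<Rightarrow> real" where
  "hamiltonian f z = ((f z $ 1)\<^sup>2 + (f z $ 2)\<^sup>2) / 2"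

end

theory Submission
  imports Defs
begin

text \<open>A solution \<open>\<gamma>\<close> of the Hamiltonian field is mapped by \<open>f\<close> to a circle about the origin, traversed
  with angular velocity \<open>det Df(\<gamma>)\<close>. If \<open>f\<close> is a homeomorphism from \<open>V\<close> onto a disc or the plane, the
  orbits in \<open>V - {z\<^sub>0}\<close> are therefore the preimages of circles, hence periodic; this gives the local
  center and one implication. Conversely, if all orbits are periodic, then \<open>det Df\<close> is bounded away
  from zero along each of them and the image of each orbit is a full circle. Take the continuous
  local inverses of \<open>f\<close> on discs about \<open>0\<close> that send \<open>0\<close> to \<open>z\<^sub>0\<close>, and let \<open>W\<close> be the union of their
  images. If \<open>p \<in> U\<close> were a boundary point of \<open>W\<close>, then the whole orbit of \<open>p\<close> would lie in the
  closure of \<open>W\<close>, and the local inverses at its points would extend the inverse on the largest disc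
  beyond its boundary circle. So \<open>W\<close> is closed in \<open>U\<close>, and \<open>W = U\<close>.\<close>

section \<open>Lifts through a local homeomorphism\<close>

text \<open>Charts have balls as images because balls and their pairwise intersections are convex,
  hence connected, which uniqueness of sections relies on.\<close>

locale local_homeo =
  fixes U :: "'a::euclidean_space set" and f :: "'a \<Rightarrow> 'a"
  assumes open_U: "open U"
    and chart: "p \<in> U \<Longrightarrow> \<exists>N \<epsilon> h. open N \<and> p \<in> N \<and> N \<subseteq> U \<and> 0 < \<epsilon> \<and> homeomorphism N (ball (f p) \<epsilon>) f h"
begin

lemma continuous_on_f: "continuous_on U f"
proof (rule continuous_at_imp_continuous_on, rule ballI)
  fix p assume "p \<in> U"
  then obtain N where "open N" "p \<in> N" "continuous_on N f"
    using chart by (meson homeomorphism_def)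
  then show "isCont f p" by (simp add: continuous_on_eq_continuous_at)
qed

text \<open>A continuous section of \<open>f\<close> over \<open>A\<close>. Sections over balls
  about \<open>0\<close> take the role of an inverse of \<open>f\<close> until injectivity is
  known.\<close>

definition lift_on :: "'a set \<Rightarrow> ('a \<Rightarrow> 'a) \<Rightarrow> bool" where
  "lift_on A h \<longleftrightarrow> continuous_on A h \<and> h ` A \<subseteq> U \<and> (\<forall>y\<in>A. f (h y) = y)"

lemma lift_on_subset: "lift_on A h \<Longrightarrow> B \<subseteq> A \<Longrightarrow> lift_on B h"
  unfolding lift_on_def by (blast intro: continuous_on_subset)

text \<open>A section is injective, having \<open>f\<close> as left inverse, and maps between spaces
  of equal dimension, so invariance of domain applies.\<close>

lemma open_lift_image:
  assumes "lift_on A h" "open A"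
  shows "open (h ` A)"
  using assms unfolding lift_on_def
  by (intro invariance_of_domain) (auto intro: inj_on_inverseI)

text \<open>The coincidence set is closed by continuity and open because \<open>f\<close> is
  injective near each common value; connectedness of \<open>A\<close> does the rest.\<close>

lemma lift_unique:
  assumes "lift_on A g" "lift_on A h" "connected A" "a \<in> A" "g a = h a" "x \<in> A"
  shows "g x = h x"
proof -
  let ?E = "{x \<in> A. g x = h x}"
  have cont: "continuous_on A g" "continuous_on A h"
    using assms unfolding lift_on_def by auto
  have "closedin (top_of_set A) ?E"
  proof -
    have "?E = {x \<in> A. g x - h x = 0}" by auto
    then show ?thesis
      using continuous_closedin_preimage_constant[OF continuous_on_diff[OF cont], of 0] by simp
  qed
  moreover have "openin (top_of_set A) ?E"
  proof (subst openin_subopen, intro ballI)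
    fix y assume y: "y \<in> ?E"
    then have "g y \<in> U" using assms(1) unfolding lift_on_def by auto
    then obtain N where N: "open N" "g y \<in> N" "inj_on f N"
      using chart by (metis homeomorphism_def inj_on_inverseI)
    \<comment> \<open>On \<open>T\<close> both sections take values in \<open>N\<close>, where
      \<open>f\<close> is injective, and \<open>f\<close> sends both values back to the same
      point.\<close>
    define T where "T = (A \<inter> g -` N) \<inter> (A \<inter> h -` N)"
    have "openin (top_of_set A) T"
      unfolding T_def using N(1) cont
      by (intro openin_Int continuous_openin_preimage_gen)
    moreover have "y \<in> T" using y N(2) by (auto simp: T_def)
    moreover have "T \<subseteq> ?E"
      using assms(1,2) N(3) unfolding T_def lift_on_def by auto (metis inj_onD)
    ultimately show "\<exists>T. openin (top_of_set A) T \<and> y \<in> T \<and> T \<subseteq> ?E" by blast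
  qed
  ultimately have "?E = A"
    using \<open>connected A\<close> assms(4,5) unfolding connected_clopen by blast
  then show ?thesis using \<open>x \<in> A\<close> by blast
qed

section \<open>Gluing and extending sections\<close>

lemma glue_lifts:
  assumes lift: "\<And>i. i \<in> I \<Longrightarrow> open (A i)" "\<And>i. i \<in> I \<Longrightarrow> lift_on (A i) (h i)"
    and agree: "\<And>i j x. i \<in> I \<Longrightarrow> j \<in> I \<Longrightarrow> x \<in> A i \<Longrightarrow> x \<in> A j \<Longrightarrow> h i x = h j x"
  obtains g where "lift_on (\<Union>i\<in>I. A i) g" "\<And>i x. i \<in> I \<Longrightarrow> x \<in> A i \<Longrightarrow> g x = h i x"
proof -
  \<comment> \<open>By \<open>agree\<close> the chosen index is immaterial: \<open>g\<close>
    coincides with each \<open>h i\<close> on the open set \<open>A i\<close>, and continuity is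
    local.\<close>
  define g where "g x = h (SOME i. i \<in> I \<and> x \<in> A i) x" for x
  have g: "g x = h i x" if "i \<in> I" "x \<in> A i" for i x
  proof -
    have "(SOME i. i \<in> I \<and> x \<in> A i) \<in> I \<and> x \<in> A (SOME i. i \<in> I \<and> x \<in> A i)"
      by (rule someI_ex) (use that in blast)
    then show ?thesis unfolding g_def using agree that by blast
  qed
  have "continuous_on (\<Union>i\<in>I. A i) g"
  proof (rule continuous_on_open_UN)
    fix i assume "i \<in> I"
    then show "open (A i)" "continuous_on (A i) g"
      using lift g by (auto simp: lift_on_def cong: continuous_on_cong)
  qed
  moreover have "g x \<in> U \<and> f (g x) = x" if "i \<in> I" "x \<in> A i" for i x
    using lift(2)[OF that(1)] that(2) g[OF that] by (auto simp: lift_on_def)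
  ultimately have "lift_on (\<Union>i\<in>I. A i) g" by (auto simp: lift_on_def)
  then show ?thesis using g that by blast
qed


text \<open>Each section at the boundary meets \<open>G\<close> in one point, hence agrees with it
  on the convex overlap. Together they glue to a section over an open neighbourhood of the compact
  closed ball, and such a neighbourhood contains a larger ball.\<close>

lemma extend_lift_ball:
  assumes "0 < \<rho>" and G: "lift_on (ball 0 \<rho>) G"
    and bd: "\<And>w. w \<in> sphere 0 \<rho> \<Longrightarrow>
      \<exists>\<epsilon> h. 0 < \<epsilon> \<and> lift_on (ball w \<epsilon>) h \<and> (\<exists>y\<in>ball w \<epsilon> \<inter> ball 0 \<rho>. h y = G y)"
  obtains r G' where "\<rho> < r" "lift_on (ball 0 r) G'" "\<And>x. x \<in> ball 0 \<rho> \<Longrightarrow> G' x = G x"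
proof -
  obtain \<epsilon> h where \<epsilon>: "\<And>w. w \<in> sphere 0 \<rho> \<Longrightarrow> 0 < \<epsilon> w"
    and h: "\<And>w. w \<in> sphere 0 \<rho> \<Longrightarrow> lift_on (ball w (\<epsilon> w)) (h w)"
    and meet: "\<And>w. w \<in> sphere 0 \<rho> \<Longrightarrow> \<exists>y\<in>ball w (\<epsilon> w) \<inter> ball 0 \<rho>. h w y = G y"
    using bd by metis
  have hG: "h w x = G x" if w: "w \<in> sphere 0 \<rho>" and x: "x \<in> ball w (\<epsilon> w) \<inter> ball 0 \<rho>" for w x
  proof -
    obtain y where y: "y \<in> ball w (\<epsilon> w) \<inter> ball 0 \<rho>" "h w y = G y" using meet[OF w] by blast
    show ?thesis
      by (rule lift_unique[OF lift_on_subset[OF h[OF w]] lift_on_subset[OF G] _ y x])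
        (auto intro: convex_connected convex_Int)
  qed
  \<comment> \<open>The overlap \<open>?B\<close> is a neighbourhood of the boundary point
    \<open>v\<close>, so it contains a point of the open ball, where both sections equal
    \<open>G\<close>.\<close>
  have hh: "h v x = h w x"
    if vw: "v \<in> sphere 0 \<rho>" "w \<in> sphere 0 \<rho>" and "v \<in> ball w (\<epsilon> w)"
      and x: "x \<in> ball v (\<epsilon> v) \<inter> ball w (\<epsilon> w)" for v w x
  proof -
    let ?B = "ball v (\<epsilon> v) \<inter> ball w (\<epsilon> w)"
    have "v \<in> ?B" using that \<epsilon> by auto
    moreover have "v \<in> closure (ball 0 \<rho>)" using vw \<open>0 < \<rho>\<close> by auto
    ultimately obtain y where y: "y \<in> ?B" "y \<in> ball 0 \<rho>"
      using open_Int_closure_eq_empty[of ?B "ball 0 \<rho>"] by blast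
    then have "h v y = h w y" using hG vw by auto
    then show ?thesis
      using lift_unique[OF lift_on_subset[OF h[OF vw(1)], of ?B] lift_on_subset[OF h[OF vw(2)], of ?B] _ y(1) _ x]
      by (auto intro: convex_connected convex_Int)
  qed
  \<comment> \<open>The index \<open>0\<close>, which is not on the sphere, stands for the big ball.
    The other radii are halved so that, when two of the small balls meet, the center of one lies in
    the full ball of the other, as \<open>hh\<close> requires.\<close>
  let ?I = "insert 0 (sphere 0 \<rho>)"
  define A where "A w = (if w = 0 then ball 0 \<rho> else ball w (\<epsilon> w / 2))" for w
  define k where "k w = (if w = 0 then G else h w)" for w
  have nz: "w \<noteq> 0" if "w \<in> sphere 0 \<rho>" for w :: 'a using that \<open>0 < \<rho>\<close> by auto
  have sub: "A w \<subseteq> ball w (\<epsilon> w)" if "w \<in> sphere 0 \<rho>" for w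
    using that \<epsilon>[OF that] nz by (auto simp: A_def)
  have agree: "k v x = k w x" if vw: "v \<in> ?I" "w \<in> ?I" and x: "x \<in> A v" "x \<in> A w" for v w x
  proof -
    consider "v = 0" "w = 0" | "v = 0" "w \<in> sphere 0 \<rho>" | "w = 0" "v \<in> sphere 0 \<rho>"
      | "v \<in> sphere 0 \<rho>" "w \<in> sphere 0 \<rho>" using vw by blast
    then show ?thesis
    proof cases
      case 4
      then have half: "x \<in> ball v (\<epsilon> v / 2)" "x \<in> ball w (\<epsilon> w / 2)"
        using vw x nz by (auto simp: A_def)
      then have "dist v w < \<epsilon> v / 2 + \<epsilon> w / 2"
        using dist_triangle2[of v w x] by (simp add: dist_commute)
      then have "v \<in> ball w (\<epsilon> w) \<or> w \<in> ball v (\<epsilon> v)"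
        by (auto simp: dist_commute)
      moreover have "x \<in> ball v (\<epsilon> v) \<inter> ball w (\<epsilon> w)" using 4 sub x by blast
      ultimately have "h v x = h w x" using hh[OF 4] hh[OF 4(2,1), symmetric] by blast
      then show ?thesis using 4 nz by (simp add: k_def)
    next
      case 2
      then show ?thesis using hG[of w x] sub[of w] x nz by (auto simp: k_def A_def)
    next
      case 3
      then show ?thesis using hG[of v x] sub[of v] x nz by (auto simp: k_def A_def)
    qed simp
  qed
  have lA: "open (A w)" "lift_on (A w) (k w)" if "w \<in> ?I" for w
    using that G lift_on_subset[OF h sub] nz by (auto simp: k_def) (auto simp: A_def)
  obtain g where g: "lift_on (\<Union>w\<in>?I. A w) g" "\<And>w x. w \<in> ?I \<Longrightarrow> x \<in> A w \<Longrightarrow> g x = k w x"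
    by (rule glue_lifts[of ?I A k]) (use lA agree in blast)+
  have "cball 0 \<rho> \<subseteq> (\<Union>w\<in>?I. A w)"
  proof
    fix x :: 'a assume "x \<in> cball 0 \<rho>"
    then have "x \<in> A 0 \<or> x \<in> sphere 0 \<rho> \<and> x \<in> A x"
      using \<epsilon>[of x] nz[of x] by (auto simp: A_def)
    then show "x \<in> (\<Union>w\<in>?I. A w)" by blast
  qed
  moreover have "open (\<Union>w\<in>?I. A w)" using lA by blast
  ultimately obtain e where e: "0 < e" "(\<Union>x\<in>cball 0 \<rho>. ball x e) \<subseteq> (\<Union>w\<in>?I. A w)"
    using compact_subset_open_imp_ball_epsilon_subset[of "cball (0::'a) \<rho>"] by (metis compact_cball)
  have "ball (0::'a) (\<rho> + e) \<subseteq> (\<Union>x\<in>cball 0 \<rho>. ball x e)"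
  proof
    fix x :: 'a assume x: "x \<in> ball 0 (\<rho> + e)"
    show "x \<in> (\<Union>x\<in>cball 0 \<rho>. ball x e)"
    proof (cases "norm x \<le> \<rho>")
      case True then show ?thesis using \<open>0 < e\<close> by force
    next
      case False
      \<comment> \<open>The radial projection onto the sphere moves \<open>x\<close> by
        \<open>norm x - \<rho>\<close>, which is less than \<open>e\<close>.\<close>
      let ?w = "(\<rho> / norm x) *\<^sub>R x"
      have "x - ?w = (1 - \<rho> / norm x) *\<^sub>R x" by (simp add: algebra_simps)
      then have "norm (x - ?w) = \<bar>1 - \<rho> / norm x\<bar> * norm x" by simp
      also have "\<dots> = norm x - \<rho>"
        using False \<open>0 < \<rho>\<close> by (cases "x = 0") (simp_all add: field_simps abs_if)
      also have "\<dots> < e" using x by simp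
      finally have "x \<in> ball ?w e" by (simp add: dist_norm norm_minus_commute)
      moreover have "?w \<in> cball 0 \<rho>" using False \<open>0 < \<rho>\<close> by (cases "x = 0") auto
      ultimately show ?thesis by blast
    qed
  qed
  then have "lift_on (ball 0 (\<rho> + e)) g"
    by (intro lift_on_subset[OF g(1)] order_trans[OF _ e(2)])
  moreover have "g x = G x" if "x \<in> ball 0 \<rho>" for x
    using g(2)[of 0 x] that by (auto simp: A_def k_def)
  ultimately show ?thesis using that[of "\<rho> + e" g] \<open>0 < e\<close> by simp
qed


text \<open>Periodic orbits enter only through the sets \<open>C\<close>, so the argument is purely
  topological. The sections over balls about \<open>0\<close> sweep out an open set \<open>W\<close>
  containing \<open>z\<^sub>0\<close>, and the spheres serve to exclude boundary points of
  \<open>W\<close> in \<open>U\<close>.\<close>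

theorem inj_and_image_ball_if_spheres:
  assumes "connected U" and z0: "z\<^sub>0 \<in> U" "f z\<^sub>0 = 0"
    and sph: "\<And>p. p \<in> U \<Longrightarrow> p \<noteq> z\<^sub>0 \<Longrightarrow>
      \<exists>C. connected C \<and> p \<in> C \<and> C \<subseteq> U \<and> f ` C = sphere 0 (norm (f p))"
  shows "inj_on f U \<and> (f ` U = UNIV \<or> (\<exists>r>0. f ` U = ball 0 r))"
proof -
  \<comment> \<open>The normalisation \<open>h 0 = z\<^sub>0\<close> makes any two of these sections
    agree on the smaller ball.\<close>
  define D where "D r h \<longleftrightarrow> 0 < r \<and> lift_on (ball 0 r) h \<and> h 0 = z\<^sub>0" for r h
  have D_unique: "g x = h x" if "D r g" "D s h" "norm x < r" "norm x < s" for r s g h x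
  proof (rule lift_unique[of "ball 0 (min r s)" g h 0 x])
    show "lift_on (ball 0 (min r s)) g" "lift_on (ball 0 (min r s)) h"
      using that by (auto simp: D_def intro: lift_on_subset)
  qed (use that in \<open>auto simp: D_def\<close>)
  define W where "W = \<Union>{h ` ball 0 r |r h. D r h}"
  \<comment> \<open>Membership in \<open>W\<close> becomes the equation \<open>h (f p) = p\<close>,
    which passes to limits.\<close>
  have W_iff: "p \<in> W \<longleftrightarrow> (\<exists>r h. D r h \<and> norm (f p) < r \<and> h (f p) = p)" for p
  proof
    assume "p \<in> W"
    then obtain r h y where h: "D r h" "norm y < r" "p = h y" by (auto simp: W_def)
    then have "f p = y" by (auto simp: D_def lift_on_def)
    then show "\<exists>r h. D r h \<and> norm (f p) < r \<and> h (f p) = p"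
      using h by (intro exI[of _ r] exI[of _ h]) simp
  next
    assume "\<exists>r h. D r h \<and> norm (f p) < r \<and> h (f p) = p"
    then obtain r h where "D r h" "f p \<in> ball 0 r" "p = h (f p)" by auto
    then show "p \<in> W" unfolding W_def by blast
  qed
  have WU: "W \<subseteq> U" by (auto simp: W_def D_def lift_on_def)
  have openW: "open W"
    unfolding W_def D_def by (auto intro!: open_Union open_lift_image)
  have local_lift: "\<exists>\<epsilon> h. 0 < \<epsilon> \<and> lift_on (ball (f p) \<epsilon>) h \<and> h (f p) = p" if "p \<in> U" for p
  proof -
    obtain N \<epsilon> h where N: "p \<in> N" "N \<subseteq> U" "0 < \<epsilon>" "homeomorphism N (ball (f p) \<epsilon>) f h"
      using chart \<open>p \<in> U\<close> by blast
    then have "lift_on (ball (f p) \<epsilon>) h" "h (f p) = p"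
      unfolding lift_on_def homeomorphism_def by auto
    then show ?thesis using N(3) by blast
  qed
  have z0W: "z\<^sub>0 \<in> W"
  proof -
    obtain \<epsilon> h where "D \<epsilon> h" using local_lift[OF z0(1)] z0 by (auto simp: D_def)
    then show ?thesis by (auto simp: W_iff z0 D_def)
  qed
  have "closedin (top_of_set U) W"
  proof -
    have "p \<in> W" if p: "p \<in> U" "p \<in> closure W" for p
    proof (cases "\<exists>r h. D r h \<and> norm (f p) < r")
      case True
      then obtain r h where Dh: "D r h" "norm (f p) < r" by blast
      \<comment> \<open>The map \<open>h\<close> after \<open>f\<close> is the identity on
        \<open>W \<inter> Q\<close> and continuous at \<open>p\<close>, a closure point of that set;
        hence it fixes \<open>p\<close>.\<close>
      define Q where "Q = U \<inter> f -` ball 0 r"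
      have "open Q" unfolding Q_def
        by (intro continuous_open_preimage continuous_on_f open_U) auto
      have fix_h: "h (f q) = q" if "q \<in> W \<inter> Q" for q
        using that D_unique[OF Dh(1)] by (auto simp: W_iff Q_def)
      have "continuous_on Q (\<lambda>q. h (f q))"
        using Dh(1) unfolding D_def lift_on_def Q_def
        by (auto intro: continuous_on_compose2 continuous_on_subset[OF continuous_on_f])
      moreover have "p \<in> Q" using p Dh by (auto simp: Q_def)
      ultimately have "isCont (\<lambda>q. h (f q)) p"
        using \<open>open Q\<close> by (simp add: continuous_on_eq_continuous_at)
      moreover have "p \<in> closure (W \<inter> Q)"
        using p \<open>p \<in> Q\<close> \<open>open Q\<close> open_Int_closure_subset[of Q W] by (auto simp: Int_commute)
      then obtain X where X: "\<And>n. X n \<in> W \<inter> Q" "X \<longlonglongrightarrow> p"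
        by (auto simp: closure_sequential)
      ultimately have "(\<lambda>n. h (f (X n))) \<longlonglongrightarrow> h (f p)"
        using isCont_tendsto_compose by blast
      then have "h (f p) = p"
        using X fix_h LIMSEQ_unique by simp
      then show ?thesis using Dh by (auto simp: W_iff)
    next
      case False
      \<comment> \<open>No centered section reaches \<open>f p\<close>, so \<open>\<rho>\<close>
        bounds all radii. The aim is to contradict this by a section over a larger ball.\<close>
      define \<rho> where "\<rho> = norm (f p)"
      have le: "r \<le> \<rho>" if "D r h" for r h using that False by (auto simp: \<rho>_def)
      have "0 < \<rho>" using z0W le by (auto simp: W_iff z0) (smt (verit) D_def)
      have radii: "\<exists>s h. D s h \<and> r < s" if "r < \<rho>" for r
      proof -
        \<comment> \<open>The neighbourhood \<open>Q\<close> of \<open>p\<close> contains a point of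
          \<open>W\<close>; its image has norm above \<open>r\<close> and lies in the domain of a
          centered section.\<close>
        define Q where "Q = U \<inter> f -` (- cball 0 r)"
        have "open Q" unfolding Q_def
          by (intro continuous_open_preimage continuous_on_f open_U) auto
        moreover have "p \<in> Q" using p that by (auto simp: Q_def \<rho>_def)
        ultimately obtain q where "q \<in> Q \<inter> W"
          using p(2) open_Int_closure_eq_empty[of Q W] by blast
        then show ?thesis by (auto simp: Q_def W_iff)
      qed
      obtain G where G: "D \<rho> G"
      proof -
        \<comment> \<open>Since the radii come arbitrarily close to \<open>\<rho>\<close>, gluing
          all centered sections gives one over the whole ball of radius
          \<open>\<rho>\<close>.\<close>
        let ?I = "{(r, h). D r h}"
        obtain g where g: "lift_on (\<Union>i\<in>?I. ball 0 (fst i)) g"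
          "\<And>i x. i \<in> ?I \<Longrightarrow> x \<in> ball 0 (fst i) \<Longrightarrow> g x = snd i x"
        proof (rule glue_lifts[of ?I "\<lambda>i. ball 0 (fst i)" snd])
          fix i j and x :: 'a assume "i \<in> ?I" "j \<in> ?I" "x \<in> ball 0 (fst i)" "x \<in> ball 0 (fst j)"
          then show "snd i x = snd j x" using D_unique by auto
        qed (auto simp: D_def)
        have "ball 0 \<rho> \<subseteq> (\<Union>i\<in>?I. ball 0 (fst i))"
          using radii by force
        then have "lift_on (ball 0 \<rho>) g" using g(1) lift_on_subset by blast
        moreover have "g 0 = z\<^sub>0"
          using radii[OF \<open>0 < \<rho>\<close>] g(2) by (force simp: D_def)
        ultimately show ?thesis using that \<open>0 < \<rho>\<close> by (auto simp: D_def)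
      qed
      have "p \<noteq> z\<^sub>0" using \<open>0 < \<rho>\<close> z0 by (auto simp: \<rho>_def)
      then obtain C where C: "connected C" "p \<in> C" "C \<subseteq> U" "f ` C = sphere 0 \<rho>"
        using sph[OF p(1)] unfolding \<rho>_def by blast
      have GW: "G y \<in> W" if "norm y < \<rho>" for y
        using that G by (auto simp: W_iff D_def lift_on_def)
      \<comment> \<open>The image of a local section through \<open>q\<close> is an open
        neighbourhood of \<open>q\<close>, so it meets \<open>W\<close>; there the local section
        agrees with a centered one and thus with \<open>G\<close>.\<close>
      have near: "\<exists>\<epsilon> h. 0 < \<epsilon> \<and> lift_on (ball (f q) \<epsilon>) h \<and> h (f q) = q \<and>
          (\<exists>y\<in>ball (f q) \<epsilon> \<inter> ball 0 \<rho>. h y = G y)" if q: "q \<in> U" "q \<in> closure W" for q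
      proof -
        obtain \<epsilon> h where h: "0 < \<epsilon>" "lift_on (ball (f q) \<epsilon>) h" "h (f q) = q"
          using local_lift q(1) by blast
        have "open (h ` ball (f q) \<epsilon>)" using h open_lift_image by blast
        moreover have "q \<in> h ` ball (f q) \<epsilon>"
          using h by (intro image_eqI[of _ _ "f q"]) auto
        ultimately obtain x where x: "x \<in> h ` ball (f q) \<epsilon>" "x \<in> W"
          using q(2) open_Int_closure_eq_empty[of "h ` ball (f q) \<epsilon>" W] by blast
        then obtain y where y: "y \<in> ball (f q) \<epsilon>" "x = h y" by blast
        then have "f x = y" using h(2) by (auto simp: lift_on_def)
        obtain r k where "D r k" "norm y < r" "k y = x" using x(2) \<open>f x = y\<close> by (auto simp: W_iff)
        moreover from this have "norm y < \<rho>" using le by force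
        ultimately have "G y = h y" using D_unique[OF G] y by metis
        then show ?thesis using h y \<open>norm y < \<rho>\<close>
          by (intro exI[of _ \<epsilon>] exI[of _ h] conjI bexI[of _ y]) auto
      qed
      \<comment> \<open>As \<open>C\<close> is connected and contains \<open>p\<close>, it suffices
        that \<open>C \<inter> closure W\<close> is open in \<open>C\<close>.\<close>
      have "C \<subseteq> closure W"
      proof -
        have "openin (top_of_set C) (C \<inter> closure W)"
        proof (subst openin_subopen, intro ballI)
          fix q assume q: "q \<in> C \<inter> closure W"
          then obtain \<epsilon> h y where h: "0 < \<epsilon>" "lift_on (ball (f q) \<epsilon>) h" "h (f q) = q"
            and y: "y \<in> ball (f q) \<epsilon> \<inter> ball 0 \<rho>" "h y = G y"
            using near C by blast
          let ?B = "ball (f q) \<epsilon>"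
          have hG: "h x = G x" if "x \<in> ?B \<inter> ball 0 \<rho>" for x
            using lift_unique[OF lift_on_subset[OF h(2), of "?B \<inter> ball 0 \<rho>"]
                lift_on_subset[of "ball 0 \<rho>" G] _ y that] G
            by (auto simp: D_def intro: convex_connected convex_Int)
          \<comment> \<open>A point of the boundary sphere is a limit of points of the open ball, at
            which \<open>h = G\<close> takes values in \<open>W\<close>.\<close>
          have "h x \<in> closure W" if x: "x \<in> ?B" "norm x = \<rho>" for x
          proof -
            have "x \<in> closure (ball 0 \<rho>)" using x \<open>0 < \<rho>\<close> by auto
            then have "x \<in> closure (?B \<inter> ball 0 \<rho>)"
              using x open_Int_closure_subset[OF open_ball, of "f q" \<epsilon> "ball 0 \<rho>"] by blast
            have "continuous_on ?B h" using h(2) by (auto simp: lift_on_def)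
            then have "isCont h x" using x by (simp add: continuous_on_eq_continuous_at)
            moreover obtain X where X: "\<And>n. X n \<in> ?B \<inter> ball 0 \<rho>" "X \<longlonglongrightarrow> x"
              using \<open>x \<in> closure (?B \<inter> ball 0 \<rho>)\<close> by (auto simp: closure_sequential)
            ultimately have "(\<lambda>n. h (X n)) \<longlonglongrightarrow> h x" by (metis isCont_tendsto_compose)
            moreover have "h (X n) \<in> W" for n using X(1)[of n] hG GW by auto
            ultimately show ?thesis
              unfolding closure_sequential by (intro exI[of _ "\<lambda>n. h (X n)"]) simp
          qed
          then have "h x \<in> closure W" if "h x \<in> C" "x \<in> ?B" for x
          proof -
            have "f (h x) \<in> sphere 0 \<rho>" "f (h x) = x"
              using C(4) h(2) that by (blast, simp add: lift_on_def)
            then show ?thesis using that \<open>\<And>x. x \<in> ?B \<Longrightarrow> norm x = \<rho> \<Longrightarrow> h x \<in> closure W\<close> by simp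
          qed
          then have "C \<inter> h ` ?B \<subseteq> closure W" by blast
          moreover have "openin (top_of_set C) (C \<inter> h ` ?B)"
            using open_lift_image[OF h(2)] by (simp add: openin_open_Int)
          moreover have "q \<in> C \<inter> h ` ?B"
            using q h by (intro IntI image_eqI[of _ _ "f q"]) auto
          ultimately show "\<exists>T. openin (top_of_set C) T \<and> q \<in> T \<and> T \<subseteq> C \<inter> closure W" by blast
        qed
        moreover have "closedin (top_of_set C) (C \<inter> closure W)" by (simp add: closedin_closed_Int)
        ultimately have "C \<inter> closure W = {} \<or> C \<inter> closure W = C"
          using C(1) unfolding connected_clopen by blast
        then show ?thesis using C(2) p(2) by blast
      qed
      \<comment> \<open>The image of \<open>C\<close> is the full sphere, so every boundary point
        comes from a point of \<open>closure W\<close>, where \<open>near\<close> supplies a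
        section.\<close>
      have "\<exists>\<epsilon> h. 0 < \<epsilon> \<and> lift_on (ball w \<epsilon>) h \<and> (\<exists>y\<in>ball w \<epsilon> \<inter> ball 0 \<rho>. h y = G y)"
        if w: "w \<in> sphere 0 \<rho>" for w
      proof -
        obtain q where "q \<in> C" "w = f q" using w C(4) by (metis imageE)
        then show ?thesis using near[of q] C(3) \<open>C \<subseteq> closure W\<close> by blast
      qed
      then obtain r G' where "\<rho> < r" "lift_on (ball 0 r) G'" "\<And>x. x \<in> ball 0 \<rho> \<Longrightarrow> G' x = G x"
        using extend_lift_ball[OF \<open>0 < \<rho>\<close>, of G] G by (metis D_def)
      then have "D r G'" using G \<open>0 < \<rho>\<close> by (auto simp: D_def)
      then show ?thesis using le \<open>\<rho> < r\<close> by force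
    qed
    then have "W = U \<inter> closure W" using WU closure_subset by blast
    then show ?thesis by (metis closed_closure closedin_closed_Int)
  qed
  moreover have "openin (top_of_set U) W" using openW WU by (simp add: openin_open_eq open_U)
  ultimately have "W = U" using \<open>connected U\<close> z0W unfolding connected_clopen by blast
  have "inj_on f U"
  proof (rule inj_onI)
    fix x y assume "x \<in> U" "y \<in> U" "f x = f y"
    then show "x = y" using D_unique unfolding \<open>W = U\<close>[symmetric] W_iff by metis
  qed
  moreover have image: "f ` U = (\<Union>r\<in>{r. \<exists>h. D r h}. ball 0 r)" (is "_ = (\<Union>r\<in>?R. _)")
  proof (intro equalityI subsetI)
    fix y assume "y \<in> f ` U"
    then obtain x where "x \<in> W" "y = f x" using \<open>W = U\<close> by blast
    then obtain r h where "D r h" "y \<in> ball 0 r" by (auto simp: W_iff)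
    then show "y \<in> (\<Union>r\<in>?R. ball 0 r)" by blast
  next
    fix y :: 'a assume "y \<in> (\<Union>r\<in>?R. ball 0 r)"
    then obtain r h where "D r h" "y \<in> ball 0 r" by blast
    then have "h y \<in> U" "f (h y) = y" by (auto simp: D_def lift_on_def)
    then show "y \<in> f ` U" by (metis imageI)
  qed
  \<comment> \<open>A union of concentric balls is the whole space if the radii are unbounded, and
    otherwise the ball whose radius is their supremum.\<close>
  moreover have "f ` U = UNIV \<or> (\<exists>r>0. f ` U = ball 0 r)"
  proof (cases "bdd_above ?R")
    case False
    then have "\<exists>r\<in>?R. norm y < r" for y :: 'a by (metis bdd_above.I not_le)
    then show ?thesis unfolding image by (simp add: set_eq_iff)
  next
    case True
    obtain r where r: "r \<in> ?R" using z0W by (auto simp: W_iff)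
    then have "0 < r" by (auto simp: D_def)
    also have "r \<le> Sup ?R" using True r by (rule cSup_upper[rotated])
    finally have "0 < Sup ?R" .
    moreover have "(\<Union>r\<in>?R. ball (0::'a) r) = ball 0 (Sup ?R)"
      using less_cSup_iff[OF _ True] r by (auto simp: set_eq_iff)
    ultimately show ?thesis unfolding image by metis
  qed
  ultimately show ?thesis by blast
qed

end

section \<open>Inverting functions with periodic derivative\<close>

text \<open>Distances grow at least by the factor \<open>c\<close> under \<open>\<phi>\<close>. So
  \<open>\<phi>\<close> is injective, unbounded in both directions and hence surjective, and its
  inverse is Lipschitz; that continuity is what the inverse rule for derivatives asks for.\<close>

lemma inverse_if_deriv_ge:
  fixes \<phi> d :: "real \<Rightarrow> real"
  assumes der: "\<And>t. (\<phi> has_real_derivative d t) (at t)"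
    and "0 < c" and ge: "\<And>t. c \<le> d t"
  obtains \<sigma> where "\<And>t. \<phi> (\<sigma> t) = t" "\<And>t. \<sigma> (\<phi> t) = t"
    "\<And>t. (\<sigma> has_real_derivative inverse (d (\<sigma> t))) (at t)"
proof -
  have expand: "c * (b - a) \<le> \<phi> b - \<phi> a" if "a \<le> b" for a b
  proof -
    have "\<phi> a - c * a \<le> \<phi> b - c * b"
    proof (rule DERIV_nonneg_imp_nondecreasing[OF that])
      fix x
      have "((\<lambda>t. \<phi> t - c * t) has_real_derivative d x - c) (at x)"
        by (auto intro!: derivative_eq_intros der)
      then show "\<exists>y. ((\<lambda>t. \<phi> t - c * t) has_real_derivative y) (at x) \<and> 0 \<le> y"
        using ge[of x] by (intro exI[of _ "d x - c"]) simp
    qed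
    then show ?thesis by (simp add: algebra_simps)
  qed
  have abs_expand: "c * \<bar>b - a\<bar> \<le> \<bar>\<phi> b - \<phi> a\<bar>" for a b
    using expand[of a b] expand[of b a] by (cases "a \<le> b") (auto simp: abs_if)
  then have inj: "inj \<phi>"
    by (intro injI) (use \<open>0 < c\<close> in \<open>smt (verit) mult_pos_pos\<close>)
  have "\<exists>x. \<phi> x = y" for y
  proof -
    \<comment> \<open>With \<open>c * b\<close> equal to the distance from \<open>\<phi> 0\<close>
      to \<open>y\<close>, expansion puts \<open>y\<close> between \<open>\<phi> (-b)\<close> and
      \<open>\<phi> b\<close>.\<close>
    define b where "b = \<bar>y - \<phi> 0\<bar> / c"
    have "0 \<le> b" "c * b = \<bar>y - \<phi> 0\<bar>" using \<open>0 < c\<close> by (auto simp: b_def)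
    then have "\<phi> (-b) \<le> y" "y \<le> \<phi> b" "-b \<le> b"
      using expand[of 0 b] expand[of "-b" 0] by auto
    then show ?thesis
      using IVT'[of \<phi> "-b" y b] DERIV_isCont[OF der] by (meson continuous_at_imp_continuous_on)
  qed
  then have "surj \<phi>" by (metis surjI)
  define \<sigma> where "\<sigma> = inv \<phi>"
  have \<phi>\<sigma>: "\<phi> (\<sigma> t) = t" and \<sigma>\<phi>: "\<sigma> (\<phi> t) = t" for t
    using inj \<open>surj \<phi>\<close> by (auto simp: \<sigma>_def surj_f_inv_f)
  have "(1 / c)-lipschitz_on UNIV \<sigma>"
  proof (rule lipschitz_onI)
    fix s t :: real
    show "dist (\<sigma> s) (\<sigma> t) \<le> 1 / c * dist s t"
      using abs_expand[of "\<sigma> s" "\<sigma> t"] \<open>0 < c\<close> by (simp add: \<phi>\<sigma> dist_real_def field_simps)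
  qed (use \<open>0 < c\<close> in simp)
  then have cont: "isCont \<sigma> t" for t
    using lipschitz_on_continuous_on continuous_on_eq_continuous_at by blast
  have "(\<sigma> has_real_derivative inverse (d (\<sigma> t))) (at t)" for t
    by (rule DERIV_inverse_function[OF der _ _ _ \<phi>\<sigma> cont, of _ "t - 1" "t + 1"])
      (use ge[of "\<sigma> t"] \<open>0 < c\<close> in auto)
  then show ?thesis using that \<phi>\<sigma> \<sigma>\<phi> by blast
qed

lemma periodic_of_int:
  fixes d :: "real \<Rightarrow> 'a"
  assumes "\<And>t. d (t + P) = d t"
  shows "d (t + of_int k * P) = d t"
proof -
  have nat: "d (t + real n * P) = d t" for n t
    using assms by (induction n) (simp_all add: algebra_simps, metis add.assoc add.commute)
  show ?thesis
  proof (cases "0 \<le> k")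
    case True
    then show ?thesis using nat[of t "nat k"] by simp
  next
    case False
    then show ?thesis using nat[of "t + of_int k * P" "nat (-k)"] by simp
  qed
qed

text \<open>The minimum of \<open>\<bar>d\<bar>\<close> over one period is a positive lower bound
  everywhere, and \<open>d\<close> has constant sign by connectedness, so
  \<open>inverse_if_deriv_ge\<close> applies to \<open>\<phi>\<close> or to its negative.\<close>

lemma inverse_if_periodic_deriv:
  fixes \<phi> d :: "real \<Rightarrow> real"
  assumes der: "\<And>t. (\<phi> has_real_derivative d t) (at t)"
    and cont: "continuous_on UNIV d" and nz: "\<And>t. d t \<noteq> 0"
    and "0 < P" and per: "\<And>t. d (t + P) = d t"
  obtains \<sigma> where "\<And>t. \<phi> (\<sigma> t) = t" "\<And>t. \<sigma> (\<phi> t) = t"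
    "\<And>t. (\<sigma> has_real_derivative inverse (d (\<sigma> t))) (at t)"
proof -
  have "continuous_on {0..P} (\<lambda>t. \<bar>d t\<bar>)"
    by (intro continuous_intros continuous_on_subset[OF cont]) auto
  then have "\<exists>s\<in>{0..P}. \<forall>t\<in>{0..P}. \<bar>d s\<bar> \<le> \<bar>d t\<bar>"
    by (intro continuous_attains_inf) (use \<open>0 < P\<close> in auto)
  then obtain s where s: "\<And>t. t \<in> {0..P} \<Longrightarrow> \<bar>d s\<bar> \<le> \<bar>d t\<bar>" by blast
  define c where "c = \<bar>d s\<bar>"
  have "0 < c" using nz by (simp add: c_def)
  have c: "c \<le> \<bar>d t\<bar>" for t
  proof -
    \<comment> \<open>Going back by this many whole periods moves \<open>t\<close> into
      \<open>{0..P}\<close>.\<close>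
    define k where "k = \<lfloor>t / P\<rfloor>"
    have "t + of_int (-k) * P \<in> {0..P}"
      using floor_divide_lower[OF \<open>0 < P\<close>, of t] floor_divide_upper[OF \<open>0 < P\<close>, of t]
      by (auto simp: k_def algebra_simps)
    then show ?thesis using s periodic_of_int[of d P t "-k"] per by (metis c_def)
  qed
  have "connected (range d)" using cont by (rule connected_continuous_image) simp
  moreover have "0 \<notin> range d" using nz by (metis imageE)
  ultimately have "(\<forall>t. 0 < d t) \<or> (\<forall>t. d t < 0)"
    using nz by (auto simp: connected_iff_interval) (metis linorder_neqE_linordered_idom less_imp_le rangeI)
  then show ?thesis
  proof
    assume "\<forall>t. 0 < d t"
    then have "c \<le> d t" for t using c[of t] by (simp add: abs_of_pos)
    then show ?thesis using inverse_if_deriv_ge[OF der \<open>0 < c\<close>] that by blast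
  next
    assume "\<forall>t. d t < 0"
    then have "c \<le> - d t" for t using c[of t] by (simp add: abs_of_neg)
    moreover have "((\<lambda>t. - \<phi> t) has_real_derivative - d t) (at t)" for t
      by (intro derivative_intros der)
    ultimately obtain \<sigma> where \<sigma>: "\<And>t. - \<phi> (\<sigma> t) = t" "\<And>t. \<sigma> (- \<phi> t) = t"
      "\<And>t. (\<sigma> has_real_derivative inverse (- d (\<sigma> t))) (at t)"
      using inverse_if_deriv_ge[of "\<lambda>t. - \<phi> t" "\<lambda>t. - d t" c] \<open>0 < c\<close> by blast
    show ?thesis
    proof (rule that[of "\<lambda>t. \<sigma> (- t)"])
      fix t
      show "\<phi> (\<sigma> (- t)) = t" using \<sigma>(1)[of "-t"] by simp
      show "\<sigma> (- \<phi> t) = t" by (rule \<sigma>(2))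
      show "((\<lambda>t. \<sigma> (- t)) has_real_derivative inverse (d (\<sigma> (- t)))) (at t)"
        using \<sigma>(3)[of "- t"] DERIV_mirror[where f = \<sigma> and x = t] by (simp add: inverse_minus_eq)
    qed
  qed
qed

section \<open>Rotations of the plane\<close>

text \<open>The counterclockwise quarter turn, i.e. multiplication by the imaginary unit.\<close>

definition perp :: "real^2 \<Rightarrow> real^2" where
  "perp w = vector [- (w $ 2), w $ 1]"

definition rot :: "real \<Rightarrow> real^2 \<Rightarrow> real^2" where
  "rot t w = cos t *\<^sub>R w + sin t *\<^sub>R perp w"

lemma perp_component [simp]: "perp w $ 1 = - (w $ 2)" "perp w $ 2 = w $ 1"
  by (simp_all add: perp_def)

lemma bounded_linear_perp: "bounded_linear perp"
  by (intro linear_conv_bounded_linear[THEN iffD1] linearI) (simp_all add: vec_eq_iff forall_2)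

lemma perp_0 [simp]: "perp w = 0 \<longleftrightarrow> w = 0"
  by (auto simp: vec_eq_iff forall_2)

lemma rot_component:
  "rot t w $ 1 = cos t * w $ 1 - sin t * w $ 2" "rot t w $ 2 = cos t * w $ 2 + sin t * w $ 1"
  by (simp_all add: rot_def)

lemma rot_rot: "rot s (rot t w) = rot (s + t) w"
  by (simp add: vec_eq_iff forall_2 rot_component cos_add sin_add algebra_simps)

lemma rot_0 [simp]: "rot 0 w = w"
  by (simp add: rot_def)

lemma rot_periodic: "rot (t + 2 * pi) w = rot t w"
  by (simp add: rot_def)

lemma norm_rot [simp]: "norm (rot t w) = norm w"
proof -
  have "(norm (rot t w))\<^sup>2 = (norm w)\<^sup>2 * ((cos t)\<^sup>2 + (sin t)\<^sup>2)"
    unfolding power2_norm_eq_inner inner_vec_def sum_2 rot_component inner_real_def by algebra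
  then show ?thesis by simp
qed

lemma rot_eq_0 [simp]: "rot t w = 0 \<longleftrightarrow> w = 0"
  using norm_rot[of t w] by (metis norm_eq_zero)

lemma rot_has_vector_derivative: "((\<lambda>t. rot t w) has_vector_derivative perp (rot t w)) (at t)"
proof -
  have "perp (rot t w) = (- sin t) *\<^sub>R w + cos t *\<^sub>R perp w"
    by (simp add: vec_eq_iff forall_2 rot_component)
  then show ?thesis
    unfolding rot_def by (auto intro!: derivative_eq_intros simp: has_real_derivative_iff_has_vector_derivative[symmetric])
qed

lemma ex_rot:
  assumes "norm v = norm w"
  shows "\<exists>t. v = rot t w"
proof (cases "w = 0")
  case False
  define N where "N = (w $ 1)\<^sup>2 + (w $ 2)\<^sup>2"
  have N: "(norm u)\<^sup>2 = (u $ 1)\<^sup>2 + (u $ 2)\<^sup>2" for u :: "real^2"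
    unfolding power2_norm_eq_inner inner_vec_def sum_2 by (simp add: power2_eq_square)
  then have "N \<noteq> 0" using False by (metis N_def norm_eq_zero power_eq_0_iff)
  have "(v $ 1)\<^sup>2 + (v $ 2)\<^sup>2 = N" using N[of v] N[of w] assms by (simp add: N_def)
  \<comment> \<open>These are the real and imaginary parts of the complex quotient
    \<open>v / w\<close>, which has modulus 1.\<close>
  let ?x = "(v $ 1 * w $ 1 + v $ 2 * w $ 2) / N" and ?y = "(v $ 2 * w $ 1 - v $ 1 * w $ 2) / N"
  have "?x\<^sup>2 + ?y\<^sup>2 = ((v $ 1)\<^sup>2 + (v $ 2)\<^sup>2) * ((w $ 1)\<^sup>2 + (w $ 2)\<^sup>2) / N\<^sup>2"
    unfolding power_divide add_divide_distrib[symmetric] by (rule arg_cong[where f = "\<lambda>x. x / N\<^sup>2"]) algebra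
  also have "\<dots> = 1"
    unfolding N_def[symmetric] \<open>(v $ 1)\<^sup>2 + (v $ 2)\<^sup>2 = N\<close> using \<open>N \<noteq> 0\<close> by (simp add: power2_eq_square)
  finally obtain t where t: "?x = cos t" "?y = sin t" by (rule sincos_total_2pi)
  have "N * cos t = v $ 1 * w $ 1 + v $ 2 * w $ 2" "N * sin t = v $ 2 * w $ 1 - v $ 1 * w $ 2"
    using t \<open>N \<noteq> 0\<close> by (auto simp: field_simps)
  then have "N * (rot t w $ 1) = N * v $ 1" "N * (rot t w $ 2) = N * v $ 2"
    unfolding rot_component N_def by algebra+
  then show ?thesis using \<open>N \<noteq> 0\<close> by (intro exI[of _ t]) (simp add: vec_eq_iff forall_2)
qed (use assms in \<open>simp add: rot_def\<close>)

section \<open>The Hamiltonian field of a planar local diffeomorphism\<close>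

locale planar_local_diffeo =
  fixes U :: "(real^2) set" and f :: "real^2 \<Rightarrow> real^2"
  assumes open_U: "open U" and C2: "Ck_on 2 f U"
    and det_nz: "z \<in> U \<Longrightarrow> det (jacobian f (at z)) \<noteq> 0"
begin

abbreviation J :: "real^2 \<Rightarrow> real^2^2" where "J z \<equiv> jacobian f (at z)"

abbreviation X :: "real^2 \<Rightarrow> real^2" where "X \<equiv> perp_gradient (hamiltonian f)"

section \<open>The differential of \<open>f\<close> and its charts\<close>

lemma deriv_f: "z \<in> U \<Longrightarrow> (f has_derivative (*v) (J z)) (at z)"
  using C2 by (simp add: numeral_2_eq_2 flip: jacobian_works)

text \<open>By \<open>C2\<close> each directional derivative is itself differentiable. Fixing the
  vector \<open>v\<close> serves both the determinant and the operator-valued derivative used for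
  the charts.\<close>

lemma continuous_on_J_mult: "continuous_on U (\<lambda>z. J z *v v)"
proof -
  have "\<forall>z\<in>U. (\<lambda>z. frechet_derivative f (at z) v) differentiable at z"
    using C2 by (simp add: numeral_2_eq_2)
  then have "continuous_on U (\<lambda>z. frechet_derivative f (at z) v)"
    by (intro differentiable_imp_continuous_on)
      (auto simp: differentiable_on_def intro: differentiable_at_withinI)
  moreover have "frechet_derivative f (at z) v = J z *v v" if "z \<in> U" for z
    using frechet_derivative_at[OF deriv_f[OF that]] by metis
  ultimately show ?thesis by (simp cong: continuous_on_cong)
qed

lemma continuous_on_det_J: "continuous_on U (\<lambda>z. det (J z))"
proof -
  have "J z $ i $ j = (J z *v axis j 1) $ i" for z i j
    by (simp add: matrix_vector_mult_basis column_def)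
  then show ?thesis
    unfolding det_2 by (auto intro!: continuous_intros continuous_on_component continuous_on_J_mult)
qed

lemma left_inverse_J:
  assumes "z \<in> U"
  obtains B where "\<And>v. B *v (J z *v v) = v"
proof -
  obtain B where "B ** J z = mat 1"
    using det_nz[OF assms] by (auto simp flip: invertible_det_nz simp: invertible_def)
  then show ?thesis using that[of B] by (simp add: matrix_vector_mul_assoc)
qed

sublocale local_homeo U f
proof
  fix p assume "p \<in> U"
  obtain B where B: "\<And>v. B *v (J p *v v) = v" using left_inverse_J[OF \<open>p \<in> U\<close>] by metis
  let ?f' = "\<lambda>z. Blinfun ((*v) (J z))"
  have Blinfun_mult: "blinfun_apply (Blinfun ((*v) A)) = (*v) A" for A :: "real^2^2"
    by (rule bounded_linear_Blinfun_apply) simp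
  have "continuous_on U ?f'"
    by (rule continuous_on_blinfun_componentwise) (simp add: Blinfun_mult continuous_on_J_mult)
  moreover have "Blinfun ((*v) B) o\<^sub>L ?f' p = id_blinfun"
    by (rule blinfun_eqI) (simp add: Blinfun_mult B)
  ultimately obtain N V h where N: "open N" "N \<subseteq> U" "p \<in> N" "open V" "f p \<in> V"
    "homeomorphism N V f h"
    using inverse_function_theorem[of U f ?f' p "Blinfun ((*v) B)"] open_U \<open>p \<in> U\<close> deriv_f
    unfolding Blinfun_mult by metis
  then obtain \<epsilon> where "0 < \<epsilon>" "ball (f p) \<epsilon> \<subseteq> V" using open_contains_ball by blast
  \<comment> \<open>The inverse function theorem yields an arbitrary open image \<open>V\<close>;
    \<open>M\<close> cuts the domain down so that the image is a ball.\<close>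
  define M where "M = N \<inter> f -` ball (f p) \<epsilon>"
  have "open M"
    unfolding M_def using N by (intro continuous_open_preimage) (auto simp: homeomorphism_def)
  moreover have "f ` M = ball (f p) \<epsilon>"
  proof (intro equalityI subsetI)
    fix y assume y: "y \<in> ball (f p) \<epsilon>"
    then have "h y \<in> N" "f (h y) = y"
      using N(6) \<open>ball (f p) \<epsilon> \<subseteq> V\<close> by (auto simp: homeomorphism_def)
    then show "y \<in> f ` M" using y unfolding M_def by (intro image_eqI[of _ _ "h y"]) auto
  qed (auto simp: M_def)
  then have "homeomorphism M (ball (f p) \<epsilon>) f h"
    using \<open>ball (f p) \<epsilon> \<subseteq> V\<close> by (intro homeomorphism_of_subsets[OF N(6)]) (auto simp: M_def)
  ultimately show "\<exists>N \<epsilon> h. open N \<and> p \<in> N \<and> N \<subseteq> U \<and> 0 < \<epsilon> \<and> homeomorphism N (ball (f p) \<epsilon>) f h"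
    using N \<open>0 < \<epsilon>\<close> by (intro exI[of _ M] exI[of _ \<epsilon>] exI[of _ h]) (auto simp: M_def)
qed (rule open_U)

text \<open>In the coordinates \<open>f\<close> the Hamiltonian is half the squared norm, so the Hamiltonian field
  is mapped to a multiple of the rotation field; the factor is the area distortion of \<open>f\<close>.\<close>

lemma J_mult_X:
  assumes "z \<in> U"
  shows "J z *v X z = det (J z) *\<^sub>R perp (f z)"
proof -
  let ?D = "\<lambda>v. f z $ 1 * (J z *v v) $ 1 + f z $ 2 * (J z *v v) $ 2"
  have comp: "((\<lambda>z. f z $ i) has_derivative (\<lambda>v. (J z *v v) $ i)) (at z)" for i
    using bounded_linear.has_derivative[OF bounded_linear_vec_nth deriv_f[OF assms]] .
  have "(hamiltonian f has_derivative ?D) (at z)"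
    unfolding hamiltonian_def [abs_def]
    by (rule has_derivative_eq_rhs, (rule derivative_intros comp)+) (auto simp: fun_eq_iff field_simps)
  from frechet_derivative_at[OF this, symmetric]
  have "partial i (hamiltonian f) z = ?D (axis i 1)" for i by (simp add: partial_def)
  then have X: "X z $ 1 = - (f z $ 1 * J z $ 1 $ 2 + f z $ 2 * J z $ 2 $ 2)"
    "X z $ 2 = f z $ 1 * J z $ 1 $ 1 + f z $ 2 * J z $ 2 $ 1"
    by (simp_all add: perp_gradient_def matrix_vector_mult_basis column_def)
  show ?thesis
    by (simp add: X vec_eq_iff forall_2 matrix_vector_mult_def sum_2 det_2 algebra_simps)
qed

lemma X_eq_0_iff: "z \<in> U \<Longrightarrow> X z = 0 \<longleftrightarrow> f z = 0"
proof
  assume z: "z \<in> U" "X z = 0"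
  then show "f z = 0" using J_mult_X[OF z(1)] det_nz[OF z(1)] by simp
next
  assume z: "z \<in> U" "f z = 0"
  obtain B where "\<And>v. B *v (J z *v v) = v" using left_inverse_J[OF z(1)] by metis
  then show "X z = 0" using J_mult_X[OF z(1)] z(2)
    by (metis matrix_vector_mult_0_right perp_0 scaleR_zero_right)
qed

section \<open>Solutions seen in the coordinates \<open>f\<close>\<close>

lemma deriv_f_along_solution:
  assumes "solution_on X D I \<gamma>" "D \<subseteq> U" "t \<in> I"
  shows "((\<lambda>t. f (\<gamma> t)) has_vector_derivative det (J (\<gamma> t)) *\<^sub>R perp (f (\<gamma> t))) (at t)"
proof -
  have "\<gamma> t \<in> U" "(\<gamma> has_vector_derivative X (\<gamma> t)) (at t)"
    using assms by (auto simp: solution_on_def)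
  then have "(\<gamma> has_derivative (\<lambda>h. h *\<^sub>R X (\<gamma> t))) (at t)"
    by (simp add: has_vector_derivative_def)
  from has_derivative_compose[OF this deriv_f[OF \<open>\<gamma> t \<in> U\<close>]]
  show ?thesis
    by (simp add: has_vector_derivative_def matrix_vector_mult_scaleR J_mult_X[OF \<open>\<gamma> t \<in> U\<close>])
qed

lemma continuous_on_solution: "solution_on X D I \<gamma> \<Longrightarrow> continuous_on I \<gamma>"
  unfolding solution_on_def
  by (meson continuous_at_imp_continuous_on has_vector_derivative_continuous)

lemma continuous_on_det_along_solution:
  assumes "solution_on X D I \<gamma>" "D \<subseteq> U"
  shows "continuous_on I (\<lambda>t. det (J (\<gamma> t)))"
  by (rule continuous_on_compose2[OF continuous_on_det_J continuous_on_solution[OF assms(1)]])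
    (use assms in \<open>auto simp: solution_on_def\<close>)

text \<open>Turning \<open>f (\<gamma> t)\<close> back by the accumulated angle
  \<open>\<phi> t\<close> gives a curve with zero derivative. The set \<open>A\<close> is a piece of
  \<open>I\<close> on which an antiderivative is at hand.\<close>

lemma f_along_solution:
  assumes sol: "solution_on X D I \<gamma>" "D \<subseteq> U"
    and A: "open A" "connected A" "A \<subseteq> I" "s \<in> A" "t \<in> A"
    and \<phi>: "\<And>t. t \<in> A \<Longrightarrow> (\<phi> has_real_derivative det (J (\<gamma> t))) (at t)"
  shows "f (\<gamma> t) = rot (\<phi> t - \<phi> s) (f (\<gamma> s))"
proof -
  let ?u = "\<lambda>t. rot (- \<phi> t) (f (\<gamma> t))"
  have "(?u has_derivative (\<lambda>h. 0)) (at x)" if "x \<in> A" for x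
  proof -
    let ?d = "det (J (\<gamma> x))" and ?w = "f (\<gamma> x)"
    have 1: "((\<lambda>t. f (\<gamma> t)) has_vector_derivative ?d *\<^sub>R perp ?w) (at x)"
      using deriv_f_along_solution[OF sol] that A by blast
    have 2: "((\<lambda>t. perp (f (\<gamma> t))) has_vector_derivative perp (?d *\<^sub>R perp ?w)) (at x)"
      by (rule bounded_linear.has_vector_derivative[OF bounded_linear_perp 1])
    have 3: "((\<lambda>t. cos (- \<phi> t)) has_real_derivative sin (- \<phi> x) * ?d) (at x)"
      "((\<lambda>t. sin (- \<phi> t)) has_real_derivative - cos (- \<phi> x) * ?d) (at x)"
      using \<phi>[OF that] by (auto intro!: derivative_eq_intros)
    have "(?u has_vector_derivative
      (cos (- \<phi> x) *\<^sub>R (?d *\<^sub>R perp ?w) + (sin (- \<phi> x) * ?d) *\<^sub>R ?w) +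
      (sin (- \<phi> x) *\<^sub>R perp (?d *\<^sub>R perp ?w) + (- cos (- \<phi> x) * ?d) *\<^sub>R perp ?w)) (at x)"
      unfolding rot_def
      by (intro has_vector_derivative_add has_vector_derivative_scaleR 1 2 3)
    \<comment> \<open>Everything cancels because applying \<open>perp\<close> twice is
      negation.\<close>
    moreover have "(cos (- \<phi> x) *\<^sub>R (?d *\<^sub>R perp ?w) + (sin (- \<phi> x) * ?d) *\<^sub>R ?w) +
      (sin (- \<phi> x) *\<^sub>R perp (?d *\<^sub>R perp ?w) + (- cos (- \<phi> x) * ?d) *\<^sub>R perp ?w) = 0"
      by (simp add: vec_eq_iff forall_2)
    ultimately show ?thesis by (simp add: has_vector_derivative_def)
  qed
  then have "?u t = ?u s" using has_derivative_zero_unique_connected[OF A(1,2)] A(4,5) by blast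
  then have "rot (\<phi> t) (?u t) = rot (\<phi> t) (?u s)" by simp
  then show ?thesis by (simp add: rot_rot)
qed

text \<open>The angular velocity along \<open>\<gamma>\<close> is continuous, periodic and never
  zero, so the angle \<open>\<phi>\<close> takes every real value and the image runs through the
  full circle.\<close>

lemma f_image_periodic_solution:
  assumes sol: "solution_on X U UNIV \<gamma>" and "0 < T" and per: "\<And>t. \<gamma> (t + T) = \<gamma> t"
  shows "f ` range \<gamma> = sphere 0 (norm (f (\<gamma> s)))"
proof -
  let ?d = "\<lambda>t. det (J (\<gamma> t))"
  have cont: "continuous_on UNIV ?d" using continuous_on_det_along_solution[OF sol] by simp
  obtain \<phi> where "\<And>t. (\<phi> has_vector_derivative ?d t) (at t)"
    using einterval_antiderivative[of "-\<infinity>" "\<infinity>" ?d] cont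
    by (auto simp: continuous_on_eq_continuous_at)
  then have \<phi>: "(\<phi> has_real_derivative ?d t) (at t)" for t
    by (simp add: has_real_derivative_iff_has_vector_derivative)
  have nz: "?d t \<noteq> 0" for t using sol det_nz by (auto simp: solution_on_def)
  obtain \<sigma> where \<sigma>: "\<And>t. \<phi> (\<sigma> t) = t"
    using inverse_if_periodic_deriv[OF \<phi> cont nz \<open>0 < T\<close>] per by metis
  have f\<gamma>: "f (\<gamma> t) = rot (\<phi> t - \<phi> s) (f (\<gamma> s))" for t
    using f_along_solution[OF sol _ open_UNIV] \<phi> by auto
  have "w \<in> f ` range \<gamma>" if w: "norm w = norm (f (\<gamma> s))" for w
  proof -
    obtain \<theta> where "w = rot \<theta> (f (\<gamma> s))" using ex_rot[OF w] by blast
    then have "w = f (\<gamma> (\<sigma> (\<theta> + \<phi> s)))" using f\<gamma>[of "\<sigma> (\<theta> + \<phi> s)"] by (simp add: \<sigma>)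
    then show ?thesis by blast
  qed
  moreover have "norm (f (\<gamma> t)) = norm (f (\<gamma> s))" for t by (subst f\<gamma>) simp
  ultimately show ?thesis by (auto simp: image_iff)
qed

section \<open>Periodic orbits over a rotation-invariant image, local or global\<close>

context
  fixes V B :: "(real^2) set" and g :: "real^2 \<Rightarrow> real^2"
  assumes V: "open V" "V \<subseteq> U" and "open B" and hom: "homeomorphism V B f g"
    and B_rot: "\<And>w t. w \<in> B \<Longrightarrow> rot t w \<in> B"
begin

text \<open>The derivative of \<open>g\<close> inverts \<open>J\<close>, and applying that inverse
  to \<open>J_mult_X\<close> turns the velocity \<open>perp\<close> of the circle into
  \<open>X\<close> divided by the determinant.\<close>

lemma lifted_circle_has_vector_derivative:
  assumes "w \<in> B"
  shows "((\<lambda>\<theta>. g (rot \<theta> w)) has_vector_derivative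
    inverse (det (J (g (rot \<theta> w)))) *\<^sub>R X (g (rot \<theta> w))) (at \<theta>)"
proof -
  define y x where "y = rot \<theta> w" and "x = g y"
  have "y \<in> B" using assms B_rot by (simp add: y_def)
  then have x: "x \<in> U" "f x = y" using hom V unfolding x_def homeomorphism_def by auto
  obtain L where L: "\<And>v. L *v (J x *v v) = v" using left_inverse_J[OF x(1)] by metis
  have "continuous (at y) g"
    using hom \<open>open B\<close> \<open>y \<in> B\<close> by (simp add: homeomorphism_def continuous_on_eq_continuous_at)
  then have "(g has_derivative (*v) L) (at y)"
    using deriv_f[OF x(1)] hom L \<open>open B\<close> \<open>y \<in> B\<close>
    by (intro has_derivative_inverse_basic[of f "(*v) (J x)" g y "(*v) L" B])
      (auto simp: x_def homeomorphism_def)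
  moreover have "((\<lambda>\<theta>. rot \<theta> w) has_derivative (\<lambda>h. h *\<^sub>R perp y)) (at \<theta>)"
    using rot_has_vector_derivative[of w \<theta>] by (simp add: has_vector_derivative_def y_def)
  ultimately have "((\<lambda>\<theta>. g (rot \<theta> w)) has_derivative (\<lambda>h. L *v (h *\<^sub>R perp y))) (at \<theta>)"
    using has_derivative_compose[of "\<lambda>\<theta>. rot \<theta> w" _ \<theta> UNIV g] by (simp add: y_def)
  moreover have "X x = det (J x) *\<^sub>R (L *v perp y)"
    using L[of "X x"] J_mult_X[OF x(1)] x(2) by (simp add: matrix_vector_mult_scaleR)
  then have "L *v perp y = inverse (det (J x)) *\<^sub>R X x" using det_nz[OF x(1)] by simp
  ultimately show ?thesis
    by (simp add: has_vector_derivative_def matrix_vector_mult_scaleR x_def y_def)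
qed

text \<open>Time is the antiderivative \<open>\<tau>\<close> of \<open>1 / det (J \<alpha>)\<close> along the lifted circle \<open>\<alpha>\<close>. Any solution
  is \<open>\<alpha> \<circ> \<phi>\<close> for an angle function \<open>\<phi>\<close>, and then \<open>(\<tau> \<circ> \<phi>)' = 1\<close>. This gives uniqueness without a
  Lipschitz condition.\<close>

lemma periodic_solution:
  assumes z: "z \<in> V" "f z \<noteq> 0"
  obtains \<beta> P where "0 < P" "solution_on X V UNIV \<beta>" "\<beta> 0 = z"
    "\<And>t. \<beta> (t + P) = \<beta> t" "\<And>t. f (\<beta> t) \<noteq> 0"
    "\<And>I \<delta> s t. solution_on X V I \<delta> \<Longrightarrow> s \<in> I \<Longrightarrow> t \<in> I \<Longrightarrow> \<delta> s = z \<Longrightarrow> \<delta> t = \<beta> (t - s)"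
proof -
  define \<alpha> where "\<alpha> \<theta> = g (rot \<theta> (f z))" for \<theta>
  have "f z \<in> B" using z hom by (auto simp: homeomorphism_def)
  then have "rot \<theta> (f z) \<in> B" for \<theta> by (rule B_rot)
  then have \<alpha>V: "\<alpha> \<theta> \<in> V" and f\<alpha>: "f (\<alpha> \<theta>) = rot \<theta> (f z)" for \<theta>
    using hom unfolding \<alpha>_def homeomorphism_def by auto
  have gf: "g (f x) = x" if "x \<in> V" for x using hom that by (simp add: homeomorphism_def)
  have \<alpha>_0: "\<alpha> 0 = z" using z gf by (simp add: \<alpha>_def)
  have \<alpha>_per: "\<alpha> (\<theta> + 2 * pi) = \<alpha> \<theta>" for \<theta> by (simp add: \<alpha>_def rot_periodic)
  let ?D = "\<lambda>\<theta>. det (J (\<alpha> \<theta>))"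
  have \<alpha>': "(\<alpha> has_vector_derivative inverse (?D \<theta>) *\<^sub>R X (\<alpha> \<theta>)) (at \<theta>)" for \<theta>
    unfolding \<alpha>_def by (rule lifted_circle_has_vector_derivative[OF \<open>f z \<in> B\<close>])
  have D_nz: "?D \<theta> \<noteq> 0" for \<theta> using \<alpha>V V det_nz by blast
  have "continuous_on UNIV \<alpha>"
    using \<alpha>' by (meson continuous_at_imp_continuous_on has_vector_derivative_continuous)
  then have contD: "continuous_on UNIV (\<lambda>\<theta>. inverse (?D \<theta>))"
    using D_nz \<alpha>V V by (intro continuous_intros continuous_on_compose2[OF continuous_on_det_J]) auto
  obtain \<tau>' where "\<And>t. (\<tau>' has_vector_derivative inverse (?D t)) (at t)"
    using einterval_antiderivative[of "-\<infinity>" "\<infinity>" "\<lambda>\<theta>. inverse (?D \<theta>)"] contD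
    by (auto simp: continuous_on_eq_continuous_at)
  then have \<tau>': "(\<tau>' has_real_derivative inverse (?D t)) (at t)" for t
    by (simp add: has_real_derivative_iff_has_vector_derivative)
  define \<tau> where "\<tau> t = \<tau>' t - \<tau>' 0" for t
  have \<tau>: "(\<tau> has_real_derivative inverse (?D t)) (at t)" for t
    unfolding \<tau>_def using \<tau>' by (auto intro!: derivative_eq_intros)
  have \<tau>_0: "\<tau> 0 = 0" by (simp add: \<tau>_def)
  obtain \<sigma> where \<tau>\<sigma>: "\<And>t. \<tau> (\<sigma> t) = t" and \<sigma>\<tau>: "\<And>t. \<sigma> (\<tau> t) = t"
    and \<sigma>: "\<And>t. (\<sigma> has_real_derivative ?D (\<sigma> t)) (at t)"
  proof (rule inverse_if_periodic_deriv[OF \<tau> contD])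
    show "inverse (?D \<theta>) \<noteq> 0" "(0::real) < 2 * pi"
      "inverse (?D (\<theta> + 2 * pi)) = inverse (?D \<theta>)" for \<theta>
      using D_nz \<alpha>_per by auto
  qed auto
  \<comment> \<open>The time of one full turn. It is negative if the determinant is negative along
    the circle, so the period is its absolute value.\<close>
  define P where "P = \<tau> (2 * pi)"
  have "\<tau> (\<theta> + 2 * pi) = \<tau> \<theta> + P" for \<theta>
  proof -
    have "((\<lambda>\<theta>. \<tau> (\<theta> + 2 * pi) - \<tau> \<theta>) has_real_derivative 0) (at x)" for x
    proof -
      have "((\<lambda>\<theta>. \<tau> (\<theta> + 2 * pi)) has_real_derivative inverse (?D x)) (at x)"
        using \<tau>[of "x + 2 * pi"] \<alpha>_per[of x] by (simp add: DERIV_shift)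
      from DERIV_diff[OF this \<tau>] show ?thesis by simp
    qed
    then have "\<tau> (\<theta> + 2 * pi) - \<tau> \<theta> = \<tau> (0 + 2 * pi) - \<tau> 0"
      by (rule DERIV_isconst_all[OF allI])
    then show ?thesis by (simp add: P_def \<tau>_0)
  qed
  then have \<sigma>_per: "\<sigma> (t + P) = \<sigma> t + 2 * pi" for t by (metis \<tau>\<sigma> \<sigma>\<tau>)
  have "P \<noteq> 0" using \<sigma>_per[of 0] by auto
  define \<beta> where "\<beta> t = \<alpha> (\<sigma> t)" for t
  have \<beta>_per: "\<beta> (t + P) = \<beta> t" for t by (simp add: \<beta>_def \<sigma>_per \<alpha>_per)
  show ?thesis
  proof (rule that[of "\<bar>P\<bar>" \<beta>])
    show "0 < \<bar>P\<bar>" using \<open>P \<noteq> 0\<close> by simp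
    show "\<beta> 0 = z" using \<sigma>\<tau>[of 0] by (simp add: \<beta>_def \<tau>_0 \<alpha>_0)
    show "\<beta> (t + \<bar>P\<bar>) = \<beta> t" for t using \<beta>_per[of t] \<beta>_per[of "t - P"] by (simp add: abs_if)
    show "f (\<beta> t) \<noteq> 0" for t
      using z(2) by (simp add: \<beta>_def f\<alpha>)
    have "(\<beta> has_vector_derivative X (\<beta> t)) (at t)" for t
    proof -
      have "((\<alpha> \<circ> \<sigma>) has_vector_derivative ?D (\<sigma> t) *\<^sub>R (inverse (?D (\<sigma> t)) *\<^sub>R X (\<alpha> (\<sigma> t)))) (at t)"
        using \<sigma> \<alpha>' by (intro vector_diff_chain_at) (simp_all add: has_real_derivative_iff_has_vector_derivative)
      then show ?thesis using D_nz by (simp add: \<beta>_def[abs_def] o_def)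
    qed
    then show "solution_on X V UNIV \<beta>" using \<alpha>V by (simp add: solution_on_def \<beta>_def)
    fix I \<delta> s t
    assume \<delta>: "solution_on X V I \<delta>" and st: "s \<in> I" "t \<in> I" and "\<delta> s = z"
    then have I: "open I" "is_interval I" by (auto simp: solution_on_def)
    \<comment> \<open>Points of \<open>I\<close> on both sides of \<open>s\<close> and
      \<open>t\<close> are needed: the antiderivative is taken on the open interval between
      them.\<close>
    obtain a where a: "a \<in> I" "a < min s t"
    proof -
      obtain e where "0 < e" "ball (min s t) e \<subseteq> I"
        using I(1) st open_contains_ball by (metis min_def)
      moreover have "min s t - e / 2 \<in> ball (min s t) e" using \<open>0 < e\<close> by (simp add: dist_real_def)
      moreover have "min s t - e / 2 < min s t" using \<open>0 < e\<close> by linarith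
      ultimately show ?thesis using that by blast
    qed
    obtain b where b: "b \<in> I" "max s t < b"
    proof -
      obtain e where "0 < e" "ball (max s t) e \<subseteq> I"
        using I(1) st open_contains_ball by (metis max_def)
      moreover have "max s t + e / 2 \<in> ball (max s t) e" using \<open>0 < e\<close> by (simp add: dist_real_def)
      moreover have "max s t < max s t + e / 2" using \<open>0 < e\<close> by linarith
      ultimately show ?thesis using that by blast
    qed
    let ?A = "{a<..<b}"
    have AI: "?A \<subseteq> I"
    proof
      fix x assume "x \<in> ?A"
      then show "x \<in> I" using mem_is_interval_1_I[OF I(2) a(1) b(1)] by simp
    qed
    have stA: "s \<in> ?A" "t \<in> ?A" using a b by auto
    have "continuous_on ?A (\<lambda>t. det (J (\<delta> t)))"
      using continuous_on_det_along_solution[OF \<delta> V(2)] AI continuous_on_subset by blast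
    then have "isCont (\<lambda>t. det (J (\<delta> t))) x" if "a < x" "x < b" for x
      using that by (simp add: continuous_on_eq_continuous_at)
    then have "\<exists>\<phi>. \<forall>x. ereal a < ereal x \<longrightarrow> ereal x < ereal b \<longrightarrow>
        (\<phi> has_vector_derivative det (J (\<delta> x))) (at x)"
      using stA by (intro einterval_antiderivative) auto
    then obtain \<phi> where \<phi>: "\<And>x. x \<in> ?A \<Longrightarrow> (\<phi> has_real_derivative det (J (\<delta> x))) (at x)"
      by (auto simp: has_real_derivative_iff_has_vector_derivative)
    have \<delta>\<alpha>: "\<delta> x = \<alpha> (\<phi> x - \<phi> s)" if "x \<in> ?A" for x
    proof -
      have "f (\<delta> x) = rot (\<phi> x - \<phi> s) (f (\<delta> s))"
        using \<delta> V(2) AI stA that \<phi> by (intro f_along_solution[of V I \<delta> ?A]) auto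
      moreover have "\<delta> x \<in> V" using that AI \<delta> by (auto simp: solution_on_def)
      ultimately show ?thesis using gf \<open>\<delta> s = z\<close> by (metis \<alpha>_def)
    qed
    have "((\<lambda>x. \<tau> (\<phi> x - \<phi> s) - x) has_derivative (\<lambda>h. 0)) (at x)" if "x \<in> ?A" for x
    proof -
      have "((\<lambda>x. \<phi> x - \<phi> s) has_real_derivative det (J (\<delta> x))) (at x)"
        using \<phi>[OF that] by (auto intro!: derivative_eq_intros)
      from DERIV_chain2[OF \<tau> this]
      have "((\<lambda>x. \<tau> (\<phi> x - \<phi> s)) has_real_derivative 1) (at x)"
        using D_nz[of "\<phi> x - \<phi> s"] \<delta>\<alpha>[OF that] by simp
      from DERIV_diff[OF this DERIV_ident] show ?thesis by (simp add: has_field_derivative_def lambda_zero)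
    qed
    then have "\<tau> (\<phi> t - \<phi> s) - t = \<tau> (\<phi> s - \<phi> s) - s"
      using stA by (intro has_derivative_zero_unique_connected[of ?A "\<lambda>x. \<tau> (\<phi> x - \<phi> s) - x" t s]) simp_all
    then have "\<tau> (\<phi> t - \<phi> s) = t - s" by (simp add: \<tau>_0)
    then have "\<phi> t - \<phi> s = \<sigma> (t - s)" by (metis \<sigma>\<tau>)
    then show "\<delta> t = \<beta> (t - s)" using \<delta>\<alpha>[OF stA(2)] by (simp add: \<beta>_def)
  qed
qed

context
  fixes z\<^sub>0 :: "real^2"
  assumes z0: "z\<^sub>0 \<in> V" "f z\<^sub>0 = 0"
begin

text \<open>Injectivity on \<open>V\<close> gives \<open>f z \<noteq> 0\<close>. Along the periodic
  solution \<open>f\<close> stays nonzero, so the solution avoids \<open>z\<^sub>0\<close>, and it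
  is not constant because \<open>X\<close> does not vanish on it.\<close>

lemma periodic_orbit_through:
  assumes "z \<in> V - {z\<^sub>0}"
  obtains \<beta> where "solution_on X (V - {z\<^sub>0}) UNIV \<beta>" "is_periodic_orbit X (V - {z\<^sub>0}) (range \<beta>)" "\<beta> 0 = z"
    "\<And>I \<delta> s t. solution_on X (V - {z\<^sub>0}) I \<delta> \<Longrightarrow> s \<in> I \<Longrightarrow> t \<in> I \<Longrightarrow> \<delta> s = z \<Longrightarrow> \<delta> t = \<beta> (t - s)"
proof -
  have z: "z \<in> V" using assms by simp
  have "f z \<noteq> 0"
    using homeomorphism_apply1[OF hom z] homeomorphism_apply1[OF hom z0(1)] z0(2) assms
    by (metis Diff_iff insertI1)
  obtain \<beta> P where \<beta>: "0 < P" "solution_on X V UNIV \<beta>" "\<beta> 0 = z"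
    "\<And>t. \<beta> (t + P) = \<beta> t" "\<And>t. f (\<beta> t) \<noteq> 0"
    "\<And>I \<delta> s t. solution_on X V I \<delta> \<Longrightarrow> s \<in> I \<Longrightarrow> t \<in> I \<Longrightarrow> \<delta> s = z \<Longrightarrow> \<delta> t = \<beta> (t - s)"
    by (rule periodic_solution[OF z \<open>f z \<noteq> 0\<close>]) blast
  have sol: "solution_on X (V - {z\<^sub>0}) UNIV \<beta>"
    using \<beta>(2,5) z0(2) by (auto simp: solution_on_def)
  have "\<not> \<beta> constant_on UNIV"
  proof
    assume "\<beta> constant_on UNIV"
    then obtain c where "\<beta> = (\<lambda>t. c)" by (auto simp: constant_on_def)
    then have "(\<beta> has_vector_derivative 0) (at 0)" by simp
    moreover have "(\<beta> has_vector_derivative X (\<beta> 0)) (at 0)"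
      using \<beta>(2) by (simp add: solution_on_def)
    ultimately have "X (\<beta> 0) = 0" by (rule vector_derivative_unique_at[symmetric])
    moreover have "\<beta> 0 \<in> U" using assms \<beta>(3) V by blast
    ultimately show False using X_eq_0_iff \<beta>(5) by blast
  qed
  then have "is_periodic_orbit X (V - {z\<^sub>0}) (range \<beta>)"
    using sol \<beta>(1,4) unfolding is_periodic_orbit_def by blast
  moreover have "solution_on X V I \<delta>" if "solution_on X (V - {z\<^sub>0}) I \<delta>" for I \<delta>
    using that by (auto simp: solution_on_def)
  ultimately show ?thesis using that sol \<beta>(3,6) by blast
qed

lemma mem_periodic_orbit:
  assumes "z \<in> V - {z\<^sub>0}"
  shows "\<exists>\<Gamma>. is_periodic_orbit X (V - {z\<^sub>0}) \<Gamma> \<and> z \<in> \<Gamma>"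
proof (rule periodic_orbit_through[OF assms])
  fix \<beta> assume "is_periodic_orbit X (V - {z\<^sub>0}) (range \<beta>)" "\<beta> 0 = z"
  then show ?thesis by blast
qed

text \<open>By uniqueness the solution defining the orbit is a restriction of a time shift of a
  periodic one; maximality forces it to be defined for all times.\<close>

lemma orbit_periodic:
  assumes "is_orbit X (V - {z\<^sub>0}) \<Gamma>"
  shows "is_periodic_orbit X (V - {z\<^sub>0}) \<Gamma>"
proof -
  obtain I \<gamma> where \<gamma>: "solution_on X (V - {z\<^sub>0}) I \<gamma>" "\<Gamma> = \<gamma> ` I"
    and max: "\<And>J \<delta>. solution_on X (V - {z\<^sub>0}) J \<delta> \<Longrightarrow> I \<subseteq> J \<Longrightarrow> (\<forall>t\<in>I. \<delta> t = \<gamma> t) \<Longrightarrow> J = I"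
    using assms unfolding is_orbit_def by blast
  then obtain s where s: "s \<in> I" by (auto simp: solution_on_def)
  then have "\<gamma> s \<in> V - {z\<^sub>0}" using \<gamma>(1) by (auto simp: solution_on_def)
  then obtain \<beta> where \<beta>: "solution_on X (V - {z\<^sub>0}) UNIV \<beta>" "is_periodic_orbit X (V - {z\<^sub>0}) (range \<beta>)"
    "\<And>I \<delta> s' t. solution_on X (V - {z\<^sub>0}) I \<delta> \<Longrightarrow> s' \<in> I \<Longrightarrow> t \<in> I \<Longrightarrow> \<delta> s' = \<gamma> s \<Longrightarrow> \<delta> t = \<beta> (t - s')"
    by (rule periodic_orbit_through[of "\<gamma> s"]) blast
  have "((\<lambda>t. \<beta> (t - s)) has_vector_derivative X (\<beta> (t - s))) (at t)" for t
  proof -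
    have "((\<beta> \<circ> (\<lambda>t. t - s)) has_vector_derivative 1 *\<^sub>R X (\<beta> (t - s))) (at t)"
      using \<beta>(1) by (intro vector_diff_chain_at) (auto simp: solution_on_def intro!: derivative_eq_intros)
    then show ?thesis by (simp add: o_def)
  qed
  then have "solution_on X (V - {z\<^sub>0}) UNIV (\<lambda>t. \<beta> (t - s))"
    using \<beta>(1) by (simp add: solution_on_def)
  moreover have eq: "\<gamma> t = \<beta> (t - s)" if "t \<in> I" for t using \<beta>(3)[OF \<gamma>(1) s that] by simp
  ultimately have "I = UNIV" using max[of UNIV "\<lambda>t. \<beta> (t - s)"] by auto
  then have "\<Gamma> = range (\<lambda>t. \<beta> (t - s))" using \<gamma>(2) eq by auto
  also have "\<dots> = range \<beta>"
    using image_image[of \<beta> "\<lambda>t. t - s" UNIV] by (simp add: surj_diff_right)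
  finally show ?thesis using \<beta>(2) by simp
qed

end

end

end

section \<open>Centers\<close>

lemma is_periodic_orbit_mono:
  "is_periodic_orbit X D \<Gamma> \<Longrightarrow> D \<subseteq> D' \<Longrightarrow> is_periodic_orbit X D' \<Gamma>"
  unfolding is_periodic_orbit_def solution_on_def by blast

context planar_local_diffeo
begin

text \<open>A chart at \<open>z\<^sub>0\<close> has a disc about \<open>0\<close> as image, which is
  rotation-invariant, so its domain serves as the neighbourhood \<open>V\<close>.\<close>

lemma is_center_zero:
  assumes "z\<^sub>0 \<in> U" "f z\<^sub>0 = 0"
  shows "is_center X U z\<^sub>0"
proof -
  obtain V \<epsilon> g where V: "open V" "z\<^sub>0 \<in> V" "V \<subseteq> U" "homeomorphism V (ball 0 \<epsilon>) f g"
    using chart[OF assms(1)] assms(2) by auto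
  have "V \<inter> {z \<in> U. X z = 0} = {z\<^sub>0}"
  proof -
    have "z = z\<^sub>0" if "z \<in> V" "f z = 0" for z
      using that homeomorphism_apply1[OF V(4)] V(2) assms(2) by metis
    then show ?thesis using V assms X_eq_0_iff by blast
  qed
  then have "z\<^sub>0 isolated_in {z \<in> U. X z = 0}"
    using V(1) assms X_eq_0_iff unfolding isolated_in_def by blast
  moreover have "is_periodic_orbit X (V - {z\<^sub>0}) \<Gamma>" if "is_orbit X (V - {z\<^sub>0}) \<Gamma>" for \<Gamma>
    by (rule orbit_periodic[OF V(1,3) open_ball V(4) _ V(2) assms(2) that]) simp
  ultimately show ?thesis using V(1-3) unfolding is_center_def by blast
qed

text \<open>Here \<open>f\<close> is a homeomorphism from all of \<open>U\<close> onto a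
  rotation-invariant open set, so the local analysis applies with \<open>V = U\<close>.\<close>

lemma period_annulus_eq_if_image_ball:
  assumes "connected U" and z0: "z\<^sub>0 \<in> U" "f z\<^sub>0 = 0" and "inj_on f U"
    and image: "f ` U = UNIV \<or> (\<exists>r>0. f ` U = ball 0 r)"
  shows "period_annulus X U z\<^sub>0 = U"
proof -
  obtain g where hom: "homeomorphism U (f ` U) f g"
    using invariance_of_domain_homeomorphism[OF open_U continuous_on_f _ \<open>inj_on f U\<close>] by blast
  have B: "open (f ` U)" using image by auto
  have B_rot: "rot t w \<in> f ` U" if "w \<in> f ` U" for t w
    using image that by (elim disjE exE conjE) simp_all
  have "\<exists>\<Gamma>. is_periodic_orbit X (U - {z\<^sub>0}) \<Gamma> \<and> z \<in> \<Gamma>" if z: "z \<in> U - {z\<^sub>0}" for z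
    by (rule mem_periodic_orbit[OF open_U order_refl B hom _ z0 z]) (rule B_rot)
  moreover have "\<Gamma> \<subseteq> U - {z\<^sub>0}" if "is_periodic_orbit X (U - {z\<^sub>0}) \<Gamma>" for \<Gamma>
    using that unfolding is_periodic_orbit_def solution_on_def by blast
  ultimately have "U - {z\<^sub>0} = \<Union>{\<Gamma>. is_periodic_orbit X (U - {z\<^sub>0}) \<Gamma>}" by blast
  moreover have "\<forall>\<Gamma>\<in>{\<Gamma>. is_periodic_orbit X (U - {z\<^sub>0}) \<Gamma>}. is_periodic_orbit X U \<Gamma>"
    using is_periodic_orbit_mono by blast
  ultimately have "punctured_filled X U z\<^sub>0 U"
    unfolding punctured_filled_def using open_U \<open>connected U\<close> z0(1) order_refl[of U] by metis
  moreover from this have "period_annulus X U z\<^sub>0 \<subseteq> U"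
    using punctured_filled_period_annulus unfolding punctured_filled_def by metis
  ultimately show ?thesis
    using punctured_filled_subset_period_annulus by (metis subset_antisym)
qed

text \<open>The periodic orbit through \<open>p\<close> is the connected set over the full circle
  that \<open>inj_and_image_ball_if_spheres\<close> asks for.\<close>

lemma inj_and_image_ball_if_period_annulus_eq:
  assumes "connected U" and z0: "z\<^sub>0 \<in> U" "f z\<^sub>0 = 0" and eq: "period_annulus X U z\<^sub>0 = U"
  shows "inj_on f U \<and> (f ` U = UNIV \<or> (\<exists>r>0. f ` U = ball 0 r))"
proof (rule inj_and_image_ball_if_spheres[OF \<open>connected U\<close> z0])
  fix p assume p: "p \<in> U" "p \<noteq> z\<^sub>0"
  \<comment> \<open>The period annulus is nonempty, so some filled \<open>W\<close> exists; hence
    the maximal one, which is \<open>U\<close>, is filled too.\<close>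
  obtain W where "punctured_filled X U z\<^sub>0 W" using z0(1) eq unfolding period_annulus_def by blast
  then have "punctured_filled X U z\<^sub>0 U" using punctured_filled_period_annulus eq by metis
  then obtain \<Gamma> where "is_periodic_orbit X U \<Gamma>" "p \<in> \<Gamma>"
    using p unfolding punctured_filled_def by blast
  then obtain \<gamma> T s where \<gamma>: "solution_on X U UNIV \<gamma>" "0 < T" "\<And>t. \<gamma> (t + T) = \<gamma> t" "p = \<gamma> s"
    unfolding is_periodic_orbit_def by blast
  have "connected (range \<gamma>)"
    using continuous_on_solution[OF \<gamma>(1)] by (rule connected_continuous_image) simp
  moreover have "range \<gamma> \<subseteq> U" using \<gamma>(1) by (auto simp: solution_on_def)
  moreover have "f ` range \<gamma> = sphere 0 (norm (f p))"
    using f_image_periodic_solution[OF \<gamma>(1-3), of s] \<gamma>(4) by simp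
  ultimately show "\<exists>C. connected C \<and> p \<in> C \<and> C \<subseteq> U \<and> f ` C = sphere 0 (norm (f p))"
    using \<gamma>(4) by blast
qed

end

theorem theorem2:
  fixes U :: "(real^2) set" and f :: "real^2 \<Rightarrow> real^2" and z\<^sub>0 :: "real^2"
  assumes "open U" and "connected U"
    and "Ck_on 2 f U"
    and "\<And>z. z \<in> U \<Longrightarrow> det (jacobian f (at z)) \<noteq> 0"
    and "z\<^sub>0 \<in> U" and "f z\<^sub>0 = 0"
  shows "is_center (perp_gradient (hamiltonian f)) U z\<^sub>0 \<and>
    (is_global_center (perp_gradient (hamiltonian f)) U z\<^sub>0 \<longleftrightarrow>
      inj_on f U \<and> (f ` U = UNIV \<or> (\<exists>r>0. f ` U = ball 0 r)))"
proof -
  interpret planar_local_diffeo U f by unfold_locales (use assms in auto)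
  have "is_center X U z\<^sub>0" using assms by (intro is_center_zero)
  moreover have "period_annulus X U z\<^sub>0 = U \<longleftrightarrow>
      inj_on f U \<and> (f ` U = UNIV \<or> (\<exists>r>0. f ` U = ball 0 r))"
    using period_annulus_eq_if_image_ball inj_and_image_ball_if_period_annulus_eq assms(2,5,6) by blast
  ultimately show ?thesis unfolding is_global_center_def by blast
qed

end
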